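(* Let $a,b,c,d,\theta$ be elements of a unital associative algebra over $\mathbb C$, and for $\lambda\in\mathbb C\setminus\{0\}$ put $$g(\lambda)=\begin{pmatrix} a & \lambda b\\ \lambda\theta+\lambda^{-1}c & d\end{pmatrix},\qquad \hat g(\lambda)=\begin{pmatrix}\lambda\theta+\lambda^{-1}c & \lambda^{-1}d\\ \lambda a & \lambda b\end{pmatrix}.$$ Each of the following matrix relations (required for all $\lambda,\mu\in\mathbb C\setminus\{0\}$) $$R_{12}(\lambda)\,g_{13}(\lambda\mu)\,g_{23}(\mu)=g_{23}(\mu)\,g_{13}(\lambda\mu)\,R_{12}(\lambda),$$ $$\hat R_{12}(\lambda)\,\hat g_{13}(\lambda\mu)\,\hat g_{23}(\mu)=\hat g_{23}(\mu)\,\hat g_{13}(\lambda\mu)\,\hat R_{12}(\lambda)$$ holds if and only if $a,b,c,d,\theta$ satisfy the defining relations of $\widetilde{GL}_q(2)$: $$[a,d]=(q-q^{-1})\,bc,\quad [b,c]=0,\quad ab=q\,ba,\quad ac=q\,ca,\quad bd=q\,db,\quad cd=q\,dc,$$ $$a\theta=q^{-1}\theta a,\quad \theta d=q^{-1}d\theta,\quad [b,\theta]=0,\quad[\theta,c]=0.$$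
   Context: Let $\gamma\in(0,\pi)$, $q=e^{i\gamma}$, and $\varpi(\lambda)=\lambda-\lambda^{-1}$. In the basis $e_1\otimes e_1,e_1\otimes e_2,e_2\otimes e_1,e_2\otimes e_2$ of $\mathbb C^2\otimes\mathbb C^2$, $$R(\lambda)=\begin{pmatrix}\varpi(q\lambda)&0&0&0\\0&\varpi(\lambda)&\varpi(q)&0\\0&\varpi(q)&\varpi(\lambda)&0\\0&0&0&\varpi(q\lambda)\end{pmatrix},\qquad \hat R(\lambda)=\begin{pmatrix}\varpi(q\lambda)&0&0&0\\0&\varpi(\lambda)&\lambda^{-1}\varpi(q)&0\\0&\lambda\varpi(q)&\varpi(\lambda)&0\\0&0&0&\varpi(q\lambda)\end{pmatrix}.$$ Subscripts indicate nontrivial tensor components in $\mathrm{Mat}(2)\otimes\mathrm{Mat}(2)\otimes\mathcal A$, where $\mathcal A$ is the algebra containing $a,b,c,d,\theta$: $R_{12}=R\otimes1$, $g_{13}=\sum E_{ij}\otimes1\otimes g_{ij}$, $g_{23}=\sum1\otimes E_{ij}\otimes g_{ij}$. *)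

theory Defs
  imports Complex_Main "Jordan_Normal_Form.Matrix"
begin

text \<open>Unital associative algebras over the complex numbers. The axiom \<open>0 \<noteq> 1\<close> of
  \<open>ring_1\<close> is not imposed, so the zero algebra is included.\<close>

class complex_algebra_1 = ring + monoid_mult +
  fixes scaleC :: "complex \<Rightarrow> 'a \<Rightarrow> 'a"  (infixr \<open>*\<^sub>C\<close> 75)
  assumes scaleC_add_right: "z *\<^sub>C (x + y) = z *\<^sub>C x + z *\<^sub>C y"
    and scaleC_add_left: "(z + w) *\<^sub>C x = z *\<^sub>C x + w *\<^sub>C x"
    and scaleC_scaleC: "z *\<^sub>C w *\<^sub>C x = (z * w) *\<^sub>C x"
    and scaleC_one: "1 *\<^sub>C x = x"
    and mult_scaleC_left: "(z *\<^sub>C x) * y = z *\<^sub>C (x * y)"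
    and mult_scaleC_right: "x * (z *\<^sub>C y) = z *\<^sub>C (x * y)"

definition commutator :: "'a::ring \<Rightarrow> 'a \<Rightarrow> 'a" where
  "commutator x y = x * y - y * x"

definition varpi :: "complex \<Rightarrow> complex" where
  "varpi l = l - inverse l"

definition R_mat :: "complex \<Rightarrow> complex \<Rightarrow> complex mat" where
  "R_mat q l = mat_of_rows_list 4
     [[varpi (q * l), 0,       0,       0],
      [0,             varpi l, varpi q, 0],
      [0,             varpi q, varpi l, 0],
      [0,             0,       0,       varpi (q * l)]]"

definition R_hat :: "complex \<Rightarrow> complex \<Rightarrow> complex mat" where
  "R_hat q l = mat_of_rows_list 4
     [[varpi (q * l), 0,           0,                   0],
      [0,             varpi l,     inverse l * varpi q, 0],
      [0,             l * varpi q, varpi l,             0],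
      [0,             0,           0,                   varpi (q * l)]]"

definition g_mat ::
  "'a::complex_algebra_1 \<Rightarrow> 'a \<Rightarrow> 'a \<Rightarrow> 'a \<Rightarrow> 'a \<Rightarrow> complex \<Rightarrow> 'a mat" where
  "g_mat a b c d \<theta> l = mat_of_rows_list 2
     [[a,                             l *\<^sub>C b],
      [l *\<^sub>C \<theta> + inverse l *\<^sub>C c, d]]"

definition g_hat ::
  "'a::complex_algebra_1 \<Rightarrow> 'a \<Rightarrow> 'a \<Rightarrow> 'a \<Rightarrow> 'a \<Rightarrow> complex \<Rightarrow> 'a mat" where
  "g_hat a b c d \<theta> l = mat_of_rows_list 2
     [[l *\<^sub>C \<theta> + inverse l *\<^sub>C c, inverse l *\<^sub>C d],
      [l *\<^sub>C a,                       l *\<^sub>C b]]"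

text \<open>\<open>Mat(2) \<otimes> Mat(2) \<otimes> \<A>\<close> is represented as the \<open>4 \<times> 4\<close> matrices over \<open>\<A>\<close>. With all
  indices counted from 0, the basis vector \<open>e\<^sub>i \<otimes> e\<^sub>j\<close> has index \<open>2 * i + j\<close>.\<close>

definition tensor3 ::
  "complex mat \<Rightarrow> complex mat \<Rightarrow> 'a::complex_algebra_1 \<Rightarrow> 'a mat" where
  "tensor3 X Y x = mat 4 4 (\<lambda>(r, s).
     (X $$ (r div 2, s div 2) * Y $$ (r mod 2, s mod 2)) *\<^sub>C x)"

definition E_unit :: "nat \<Rightarrow> nat \<Rightarrow> complex mat" where
  "E_unit i j = mat 2 2 (\<lambda>rs. if rs = (i, j) then 1 else 0)"

text \<open>\<open>leg12 M = M \<otimes> 1\<close>, \<open>leg13 G = \<Sum> E\<^sub>i\<^sub>j \<otimes> 1 \<otimes> G\<^sub>i\<^sub>j\<close> and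
  \<open>leg23 G = \<Sum> 1 \<otimes> E\<^sub>i\<^sub>j \<otimes> G\<^sub>i\<^sub>j\<close>. The sums are taken entrywise because the type of
  matrices of all sizes has no zero matrix to sum from.\<close>

definition leg12 :: "complex mat \<Rightarrow> 'a::complex_algebra_1 mat" where
  "leg12 M = map_mat (\<lambda>z. z *\<^sub>C 1) M"

definition leg13 :: "'a::complex_algebra_1 mat \<Rightarrow> 'a mat" where
  "leg13 G = mat 4 4 (\<lambda>rs. \<Sum>i<2. \<Sum>j<2. tensor3 (E_unit i j) (1\<^sub>m 2) (G $$ (i, j)) $$ rs)"

definition leg23 :: "'a::complex_algebra_1 mat \<Rightarrow> 'a mat" where
  "leg23 G = mat 4 4 (\<lambda>rs. \<Sum>i<2. \<Sum>j<2. tensor3 (1\<^sub>m 2) (E_unit i j) (G $$ (i, j)) $$ rs)"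

definition GLq2_tilde_relations ::
  "complex \<Rightarrow> 'a::complex_algebra_1 \<Rightarrow> 'a \<Rightarrow> 'a \<Rightarrow> 'a \<Rightarrow> 'a \<Rightarrow> bool" where
  "GLq2_tilde_relations q a b c d \<theta> \<longleftrightarrow>
     commutator a d = (q - inverse q) *\<^sub>C (b * c) \<and>
     commutator b c = 0 \<and>
     a * b = q *\<^sub>C (b * a) \<and>
     a * c = q *\<^sub>C (c * a) \<and>
     b * d = q *\<^sub>C (d * b) \<and>
     c * d = q *\<^sub>C (d * c) \<and>
     a * \<theta> = inverse q *\<^sub>C (\<theta> * a) \<and>
     \<theta> * d = inverse q *\<^sub>C (d * \<theta>) \<and>
     commutator b \<theta> = 0 \<and>
     commutator \<theta> c = 0"

end

theory Submission
  imports Defs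
begin

text \<open>Each matrix relation is a system of sixteen equations in the algebra, one for each entry
  of a \<open>4 \<times> 4\<close> matrix. The difference of the two sides of an entry is called its defect. Both
  \<open>R\<close> and the rule attaching powers of \<open>\<lambda>\<close> to the generators are such that every defect collapses
  to a common factor \<open>\<varpi>(\<lambda>)\<close> times a combination of the quantities that the defining relations
  of the quantum group set to zero (\<open>g_exchange_defects\<close>). The reason is that, with \<open>\<varpi>(q\<lambda>)\<close>,
  \<open>\<varpi>(\<lambda>)\<close> and \<open>\<varpi>(q)\<close> the three nonzero entries of \<open>R\<close>,
  \<open>\<varpi>(q\<lambda>) - \<lambda> \<varpi>(q) = q\<inverse> \<varpi>(\<lambda>)\<close> and \<open>\<varpi>(q\<lambda>) - \<lambda>\<inverse> \<varpi>(q) = q \<varpi>(\<lambda>)\<close>,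
  so that for instance \<open>\<varpi>(q\<lambda>) ab = \<varpi>(\<lambda>) ba + \<lambda> \<varpi>(q) ab\<close> says \<open>ab = q ba\<close>.

  Hence the relations make all defects vanish. Conversely, for one \<open>\<lambda>\<close> at which \<open>\<varpi>(\<lambda>)\<close> and
  \<open>\<varpi>(q\<lambda>)\<close> are nonzero, seven defects suffice to recover all relations: where two relations occur
  in the same entry, they sit at \<open>\<mu>\<close> and \<open>\<mu>\<inverse>\<close> and are separated by varying \<open>\<mu>\<close>
  (\<open>laurent_binomial_eq_0\<close>).

  The hatted relation is the same one in another gauge. Let \<open>D(\<lambda>)\<close> be the diagonal matrix with
  entries \<open>1, \<lambda>\<close>, and \<open>\<sigma>\<close> the matrix exchanging the two basis vectors. Then
  \<open>g_hat(\<lambda>) = D(\<lambda>) \<sigma> g(\<lambda>) D(\<lambda>)\<inverse>\<close>, and \<open>R_hat(\<lambda>)\<close> is the conjugate of \<open>R(\<lambda>)\<close> by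
  \<open>D(\<lambda>\<mu>) \<otimes> D(\<mu>)\<close>, for every \<open>\<mu>\<close>. As \<open>R\<close> commutes with \<open>\<sigma> \<otimes> \<sigma>\<close>, the hatted defects are
  nonzero multiples of the plain ones with the rows reversed (\<open>hat_exchange_defect\<close>), so the two
  relations are equivalent already for each single pair \<open>\<lambda>, \<mu>\<close>.\<close>

section \<open>Complex scalars\<close>

context complex_algebra_1
begin

lemma scaleC_zero_right: "z *\<^sub>C 0 = 0"
  using scaleC_add_right[of z 0 0] by simp

lemma scaleC_zero_left: "0 *\<^sub>C x = 0"
  using scaleC_add_left[of 0 0 x] by simp

lemma scaleC_minus_right: "z *\<^sub>C (- x) = - (z *\<^sub>C x)"
  using scaleC_add_right[of z x "- x"]
  by (simp add: scaleC_zero_right) (metis minus_unique)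

lemma scaleC_minus_left: "(- z) *\<^sub>C x = - (z *\<^sub>C x)"
  using scaleC_add_left[of z "- z" x]
  by (simp add: scaleC_zero_left) (metis minus_unique)

lemma scaleC_diff_right: "z *\<^sub>C (x - y) = z *\<^sub>C x - z *\<^sub>C y"
  using scaleC_add_right[of z x "- y"] by (simp add: scaleC_minus_right)

lemma scaleC_diff_left: "(z - w) *\<^sub>C x = z *\<^sub>C x - w *\<^sub>C x"
  using scaleC_add_left[of z "- w" x] by (simp add: scaleC_minus_left)

lemma scaleC_eq_0_iff: "z \<noteq> 0 \<Longrightarrow> z *\<^sub>C x = 0 \<longleftrightarrow> x = 0"
  by (metis left_inverse scaleC_one scaleC_scaleC scaleC_zero_right)

end

lemma scaleC_sum_right: "z *\<^sub>C sum f A = (\<Sum>t\<in>A. z *\<^sub>C (f t :: 'a::complex_algebra_1))"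
  by (induction A rule: infinite_finite_induct) (simp_all add: scaleC_zero_right scaleC_add_right)

text \<open>Separates two relations that appear together in one matrix entry. The values at \<open>m = 1\<close> and
  \<open>m = \<i>\<close> already give \<open>x + y = 0\<close> and \<open>x - y = 0\<close>.\<close>

lemma laurent_binomial_eq_0:
  fixes x y :: "'a::complex_algebra_1"
  assumes "\<And>m. m \<noteq> 0 \<Longrightarrow> m *\<^sub>C x + inverse m *\<^sub>C y = 0"
  shows "x = 0" "y = 0"
proof -
  have 1: "x + y = 0"
    using assms[of 1] by (simp add: scaleC_one)
  have "\<i> *\<^sub>C (x - y) = 0"
    using assms[of \<i>] by (simp add: scaleC_diff_right scaleC_minus_left)
  then have "x = y"
    by (simp add: scaleC_eq_0_iff)
  with 1 have "2 *\<^sub>C x = 0"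
    using scaleC_add_left[of 1 1 x] by (simp add: scaleC_one)
  then show "x = 0"
    by (simp add: scaleC_eq_0_iff)
  with \<open>x = y\<close> show "y = 0" by simp
qed

section \<open>Entries of the exchange relation\<close>

lemma less_4_cases: "(r::nat) < 4 \<longleftrightarrow> r = 0 \<or> r = 1 \<or> r = 2 \<or> r = 3"
  by auto

lemma sum_less_2: "(\<Sum>t<(2::nat). f t) = f 0 + f 1"
  by (simp add: numeral_2_eq_2)

lemma sum_less_4: "(\<Sum>t<(4::nat). f t) = f 0 + f 1 + f 2 + f 3"
  by (simp add: eval_nat_numeral)

lemma leg13_index:
  assumes "r < 4" "s < 4"
  shows "leg13 G $$ (r, s) = (if r mod 2 = s mod 2 then G $$ (r div 2, s div 2) else 0)"
  using assms
  by (auto simp: leg13_def tensor3_def E_unit_def sum_less_2 less_4_cases scaleC_one scaleC_zero_left)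

lemma leg23_index:
  assumes "r < 4" "s < 4"
  shows "leg23 G $$ (r, s) = (if r div 2 = s div 2 then G $$ (r mod 2, s mod 2) else 0)"
  using assms
  by (auto simp: leg23_def tensor3_def E_unit_def sum_less_2 less_4_cases scaleC_one scaleC_zero_left)

lemma leg_carrier: "leg13 G \<in> carrier_mat 4 4" "leg23 G \<in> carrier_mat 4 4"
  by (simp_all add: leg13_def leg23_def)

lemma leg12_carrier: "X \<in> carrier_mat 4 4 \<Longrightarrow> leg12 X \<in> carrier_mat 4 4"
  by (simp add: leg12_def)

lemma mult_mat_index_4:
  fixes A B :: "'a::semiring_0 mat"
  assumes "A \<in> carrier_mat 4 4" "B \<in> carrier_mat 4 4" "r < 4" "s < 4"
  shows "(A * B) $$ (r, s) = (\<Sum>t<4. A $$ (r, t) * B $$ (t, s))"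
  using assms by (simp add: scalar_prod_def atLeast0LessThan)

lemma leg13_leg23_index:
  assumes "r < 4" "s < 4"
  shows "(leg13 G * leg23 H) $$ (r, s) = G $$ (r div 2, s div 2) * H $$ (r mod 2, s mod 2)"
  using assms
  unfolding less_4_cases
  by (elim disjE; simp add: mult_mat_index_4 leg_carrier sum_less_4 leg13_index leg23_index)

lemma leg23_leg13_index:
  assumes "r < 4" "s < 4"
  shows "(leg23 H * leg13 G) $$ (r, s) = H $$ (r mod 2, s mod 2) * G $$ (r div 2, s div 2)"
  using assms
  unfolding less_4_cases
  by (elim disjE; simp add: mult_mat_index_4 leg_carrier sum_less_4 leg13_index leg23_index)

text \<open>The entry in row \<open>r\<close>, column \<open>s\<close> of the difference
  \<open>X\<^sub>1\<^sub>2 G\<^sub>1\<^sub>3 H\<^sub>2\<^sub>3 - H\<^sub>2\<^sub>3 G\<^sub>1\<^sub>3 X\<^sub>1\<^sub>2\<close>, with the triple products already multiplied out: each entry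
  of \<open>G\<^sub>1\<^sub>3 H\<^sub>2\<^sub>3\<close> and of \<open>H\<^sub>2\<^sub>3 G\<^sub>1\<^sub>3\<close> is a single product in the algebra.\<close>

definition exchange_defect ::
  "complex mat \<Rightarrow> 'a::complex_algebra_1 mat \<Rightarrow> 'a mat \<Rightarrow> nat \<Rightarrow> nat \<Rightarrow> 'a" where
  "exchange_defect X G H r s =
     (\<Sum>t<4. X $$ (r, t) *\<^sub>C (G $$ (t div 2, s div 2) * H $$ (t mod 2, s mod 2)))
   - (\<Sum>t<4. X $$ (t, s) *\<^sub>C (H $$ (r mod 2, t mod 2) * G $$ (r div 2, t div 2)))"

lemma exchange_relation_iff:
  fixes G H :: "'a::complex_algebra_1 mat"
  assumes X: "X \<in> carrier_mat 4 4"
  shows "leg12 X * leg13 G * leg23 H = leg23 H * leg13 G * leg12 X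
     \<longleftrightarrow> (\<forall>r<4. \<forall>s<4. exchange_defect X G H r s = 0)"
    (is "?L = ?R \<longleftrightarrow> _")
proof -
  note carriers = leg12_carrier[OF X] leg_carrier[of G] leg_carrier[of H]
  have "?L $$ (r, s) - ?R $$ (r, s) = exchange_defect X G H r s" if rs: "r < 4" "s < 4" for r s
  proof -
    have "?L $$ (r, s) = (leg12 X * (leg13 G * leg23 H)) $$ (r, s)"
      using assoc_mult_mat[OF carriers(1,2,5)] by simp
    also have "\<dots> = (\<Sum>t<4. leg12 X $$ (r, t) * (leg13 G * leg23 H) $$ (t, s))"
      by (rule mult_mat_index_4) (use carriers rs in auto)
    also have "\<dots> = (\<Sum>t<4. X $$ (r, t) *\<^sub>C (G $$ (t div 2, s div 2) * H $$ (t mod 2, s mod 2)))"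
      using X rs by (intro sum.cong) (simp_all add: leg13_leg23_index leg12_def mult_scaleC_left)
    finally have L: "?L $$ (r, s) = \<dots>" .
    have "?R $$ (r, s) = (\<Sum>t<4. (leg23 H * leg13 G) $$ (r, t) * leg12 X $$ (t, s))"
      by (rule mult_mat_index_4) (use carriers rs in auto)
    also have "\<dots> = (\<Sum>t<4. X $$ (t, s) *\<^sub>C (H $$ (r mod 2, t mod 2) * G $$ (r div 2, t div 2)))"
      using X rs by (intro sum.cong) (simp_all add: leg23_leg13_index leg12_def mult_scaleC_right)
    finally show ?thesis
      using L by (simp add: exchange_defect_def)
  qed
  moreover have "?L = ?R \<longleftrightarrow> (\<forall>r<4. \<forall>s<4. ?L $$ (r, s) - ?R $$ (r, s) = 0)"
  proof -
    have "?L \<in> carrier_mat 4 4" "?R \<in> carrier_mat 4 4"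
      by (intro mult_carrier_mat[of _ 4 4] carriers)+
    then show ?thesis
      unfolding mat_eq_iff carrier_mat_def by auto
  qed
  ultimately show ?thesis by simp
qed

section \<open>The plain relation\<close>

lemma mat_of_rows_list_index:
  assumes "r < length xss" "s < n"
  shows "mat_of_rows_list n xss $$ (r, s) = xss ! r ! s"
  using assms by (simp add: mat_of_rows_list_def)

lemma R_carrier: "R_mat q l \<in> carrier_mat 4 4" "R_hat q l \<in> carrier_mat 4 4"
  unfolding R_mat_def R_hat_def mat_of_rows_list_def by (rule carrier_matI; simp)+

lemma inverse_cancel_left:
  fixes z w :: complex
  assumes "z \<noteq> 0"
  shows "z * (inverse z * w) = w" "inverse z * (z * w) = w"
  using assms by simp_all

lemmas expand_defect =
  exchange_defect_def R_mat_def g_mat_def mat_of_rows_list_index sum_less_4 varpi_def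
  commutator_def scaleC_zero_left

lemmas expand_scaleC =
  scaleC_add_right scaleC_add_left scaleC_diff_right scaleC_diff_left scaleC_minus_left
  scaleC_minus_right scaleC_scaleC scaleC_zero_right scaleC_one mult_scaleC_left mult_scaleC_right

text \<open>Every defect is \<open>varpi l\<close> times a combination of the defects of the defining relations. To
  verify an entry, both sides are expanded until each scalar is a Laurent monomial in \<open>l\<close>, \<open>m\<close>
  and \<open>q\<close>.

  Away from the corners, an entry in the first or last row or column exchanges just two entries
  of \<open>g\<close>, which do so in one further entry. Where \<open>\<theta>\<close> and \<open>c\<close> meet \<open>a\<close>, \<open>b\<close> or \<open>d\<close> through the lower
  left entry of \<open>g\<close>, their relations come with opposite powers of \<open>m\<close>, except in the two diagonal
  entries: there the difference of two products taken at \<open>l * m\<close> and \<open>m\<close> leaves only the terms in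
  \<open>c\<close>, which supply the right-hand side of the relation for \<open>ad\<close>.\<close>

lemma g_exchange_defects:
  fixes a b c d \<theta> :: "'a::complex_algebra_1"
  assumes nz: "q \<noteq> 0" "l \<noteq> 0" "m \<noteq> 0"
  defines "D \<equiv> exchange_defect (R_mat q l) (g_mat a b c d \<theta> (l * m)) (g_mat a b c d \<theta> m)"
  shows "D 0 0 = 0"
    and "D 0 1 = (varpi l * m * inverse q) *\<^sub>C (a * b - q *\<^sub>C (b * a))"
    and "D 0 2 = (varpi l * - (l * m)) *\<^sub>C (a * b - q *\<^sub>C (b * a))"
    and "D 0 3 = 0"
    and "D 1 0 = varpi l *\<^sub>C (m *\<^sub>C (a * \<theta> - inverse q *\<^sub>C (\<theta> * a))
                            + inverse m *\<^sub>C (a * c - q *\<^sub>C (c * a)))"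
    and "D 1 1 = varpi l *\<^sub>C (commutator a d - varpi q *\<^sub>C (b * c) + varpi q *\<^sub>C commutator b c)"
    and "D 1 2 = (varpi l * (l * m)) *\<^sub>C (m *\<^sub>C commutator b \<theta> + inverse m *\<^sub>C commutator b c)"
    and "D 1 3 = (varpi l * (l * m)) *\<^sub>C (b * d - q *\<^sub>C (d * b))"
    and "D 2 0 = - varpi l *\<^sub>C ((q * l * m) *\<^sub>C (a * \<theta> - inverse q *\<^sub>C (\<theta> * a))
                            + inverse (q * l * m) *\<^sub>C (a * c - q *\<^sub>C (c * a)))"
    and "D 2 1 = (varpi l * - m) *\<^sub>C ((l * m) *\<^sub>C commutator b \<theta> + inverse (l * m) *\<^sub>C commutator b c)"
    and "D 2 2 = - varpi l *\<^sub>C (commutator a d - varpi q *\<^sub>C (b * c))"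
    and "D 2 3 = (varpi l * - (m * inverse q)) *\<^sub>C (b * d - q *\<^sub>C (d * b))"
    and "D 3 0 = (varpi (q * l) * varpi l) *\<^sub>C commutator \<theta> c"
    and "D 3 1 = varpi l *\<^sub>C ((q * l * m) *\<^sub>C (\<theta> * d - inverse q *\<^sub>C (d * \<theta>))
                            + inverse (q * l * m) *\<^sub>C (c * d - q *\<^sub>C (d * c)))"
    and "D 3 2 = - varpi l *\<^sub>C (m *\<^sub>C (\<theta> * d - inverse q *\<^sub>C (d * \<theta>))
                            + inverse m *\<^sub>C (c * d - q *\<^sub>C (d * c)))"
    and "D 3 3 = 0"
  unfolding D_def
  by (simp_all add: expand_defect, simp_all add: expand_scaleC algebra_simps inverse_cancel_left nz,
      simp_all add: field_simps nz scaleC_one)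

text \<open>Since \<open>varpi z\<close> vanishes only for \<open>z\<^sup>2 = 1\<close>, at most one of \<open>l = 2\<close> and \<open>l = 3\<close> can make
  \<open>varpi (q * l)\<close> vanish.\<close>

lemma regular_spectral_parameter:
  assumes q: "q \<noteq> 0"
  shows "\<exists>l. l \<noteq> 0 \<and> varpi l \<noteq> 0 \<and> varpi (q * l) \<noteq> 0"
proof -
  have sq: "varpi z * z = z\<^sup>2 - 1" if "z \<noteq> 0" for z
    using that by (simp add: varpi_def algebra_simps power2_eq_square)
  show ?thesis
  proof (cases "varpi (q * 2) = 0")
    case True
    then have "q\<^sup>2 = 1 / 4"
      using sq[of "q * 2"] q by (simp add: power_mult_distrib)
    moreover have "varpi (q * 3) * (q * 3) = q\<^sup>2 * 3\<^sup>2 - 1"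
      using sq[of "q * 3"] q by (simp add: power_mult_distrib)
    ultimately have "varpi (q * 3) * (q * 3) = 1 / 4 * 3\<^sup>2 - 1"
      by (simp only:)
    then have "varpi (q * 3) \<noteq> 0"
      by auto
    moreover have "varpi 3 \<noteq> 0"
      by (simp add: varpi_def)
    ultimately show ?thesis
      by (intro exI[of _ 3]) simp
  next
    case False
    moreover have "varpi 2 \<noteq> 0"
      by (simp add: varpi_def)
    ultimately show ?thesis
      by (intro exI[of _ 2]) simp
  qed
qed

lemma g_exchange_iff_relations:
  fixes a b c d \<theta> :: "'a::complex_algebra_1"
  assumes q: "q \<noteq> 0"
  shows "(\<forall>l m. l \<noteq> 0 \<longrightarrow> m \<noteq> 0 \<longrightarrow> (\<forall>r<4. \<forall>s<4.
            exchange_defect (R_mat q l) (g_mat a b c d \<theta> (l * m)) (g_mat a b c d \<theta> m) r s = 0))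
     \<longleftrightarrow> GLq2_tilde_relations q a b c d \<theta>" (is "?vanish \<longleftrightarrow> _")
proof
  assume ?vanish
  obtain l where l: "l \<noteq> 0" "varpi l \<noteq> 0" "varpi (q * l) \<noteq> 0"
    using regular_spectral_parameter[OF q] by blast
  define D where
    "D m = exchange_defect (R_mat q l) (g_mat a b c d \<theta> (l * m)) (g_mat a b c d \<theta> m)" for m
  have vanish: "D m r s = 0" if "m \<noteq> 0" "r < 4" "s < 4" for m r s
    using \<open>?vanish\<close> l that by (simp add: D_def)
  note defects = g_exchange_defects[OF q l(1), of _ a b c d \<theta>, folded D_def]
  \<comment> \<open>The relations for \<open>ab\<close>, \<open>bd\<close>, \<open>\<theta>c\<close> and \<open>ad\<close> each fill an entry of their own, so \<open>m = 1\<close>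
      is enough; the others come in pairs, and \<open>m\<close> has to vary.\<close>
  have ab: "a * b - q *\<^sub>C (b * a) = 0"
    using vanish[of 1 0 1] q l by (simp add: defects scaleC_eq_0_iff del: One_nat_def)
  have bd: "b * d - q *\<^sub>C (d * b) = 0"
    using vanish[of 1 1 3] q l by (simp add: defects scaleC_eq_0_iff del: One_nat_def)
  have tc: "commutator \<theta> c = 0"
    using vanish[of 1 3 0] q l by (simp add: defects scaleC_eq_0_iff)
  have ad: "commutator a d - varpi q *\<^sub>C (b * c) = 0"
    using vanish[of 1 2 2] q l by (simp add: defects scaleC_eq_0_iff)
  have "m *\<^sub>C (a * \<theta> - inverse q *\<^sub>C (\<theta> * a)) + inverse m *\<^sub>C (a * c - q *\<^sub>C (c * a)) = 0"
    if "m \<noteq> 0" for m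
    using vanish[of m 1 0] that q l by (simp add: defects scaleC_eq_0_iff del: One_nat_def)
  note at_ac = laurent_binomial_eq_0[OF this]
  have "m *\<^sub>C commutator b \<theta> + inverse m *\<^sub>C commutator b c = 0" if "m \<noteq> 0" for m
    using vanish[of m 1 2] that q l by (simp add: defects scaleC_eq_0_iff del: One_nat_def)
  note bt_bc = laurent_binomial_eq_0[OF this]
  have "m *\<^sub>C (\<theta> * d - inverse q *\<^sub>C (d * \<theta>)) + inverse m *\<^sub>C (c * d - q *\<^sub>C (d * c)) = 0"
    if "m \<noteq> 0" for m
    using vanish[of m 3 2] that q l by (simp add: defects scaleC_eq_0_iff)
  note td_cd = laurent_binomial_eq_0[OF this]
  show "GLq2_tilde_relations q a b c d \<theta>"
    using ab bd tc ad at_ac bt_bc td_cd by (simp add: GLq2_tilde_relations_def varpi_def)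
next
  assume "GLq2_tilde_relations q a b c d \<theta>"
  then have zeros:
    "a * b - q *\<^sub>C (b * a) = 0" "a * c - q *\<^sub>C (c * a) = 0"
    "b * d - q *\<^sub>C (d * b) = 0" "c * d - q *\<^sub>C (d * c) = 0"
    "a * \<theta> - inverse q *\<^sub>C (\<theta> * a) = 0" "\<theta> * d - inverse q *\<^sub>C (d * \<theta>) = 0"
    "commutator b c = 0" "commutator b \<theta> = 0" "commutator \<theta> c = 0"
    "commutator a d - varpi q *\<^sub>C (b * c) = 0"
    by (simp_all add: GLq2_tilde_relations_def varpi_def)
  show ?vanish
  proof (intro allI impI)
    fix l m :: complex and r s :: nat
    assume lm: "l \<noteq> 0" "m \<noteq> 0" and "r < 4" "s < 4"
    then have "r = 0 \<or> r = 1 \<or> r = 2 \<or> r = 3" "s = 0 \<or> s = 1 \<or> s = 2 \<or> s = 3"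
      by (simp_all add: less_4_cases)
    then show "exchange_defect (R_mat q l) (g_mat a b c d \<theta> (l * m)) (g_mat a b c d \<theta> m) r s = 0"
      by (elim disjE; simp only: g_exchange_defects[OF q lm] zeros scaleC_zero_right add_0_right)
  qed
qed

section \<open>The hatted relation by a change of gauge\<close>

text \<open>The diagonal entries of \<open>D(lm) \<otimes> D(m)\<close>, where \<open>D(l)\<close> is diagonal with entries \<open>1, l\<close>.\<close>

definition gauge :: "complex \<Rightarrow> complex \<Rightarrow> nat \<Rightarrow> complex" where
  "gauge l m r = (l * m) ^ (r div 2) * m ^ (r mod 2)"

lemma gauge_nonzero: "l \<noteq> 0 \<Longrightarrow> m \<noteq> 0 \<Longrightarrow> gauge l m r \<noteq> 0"
  by (simp add: gauge_def)

text \<open>Although the gauge depends on \<open>m\<close>, the conjugate of \<open>R\<close> does not: \<open>R\<close> only connects basis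
  vectors carrying the same power of \<open>m\<close>.\<close>

lemma R_hat_gauge:
  assumes "l \<noteq> 0" "m \<noteq> 0" "r < 4" "t < 4"
  shows "R_hat q l $$ (r, t) = gauge l m r * inverse (gauge l m t) * R_mat q l $$ (r, t)"
  using assms
  by (auto simp: less_4_cases gauge_def R_hat_def R_mat_def mat_of_rows_list_index
      simp flip: divide_inverse)
    (simp add: divide_inverse mult.commute)

text \<open>Exchanging the basis vectors in both tensor factors sends the index \<open>r\<close> to \<open>3 - r\<close>.\<close>

lemma R_mat_flip:
  assumes "r < 4" "t < 4"
  shows "R_mat q l $$ (3 - r, 3 - t) = R_mat q l $$ (r, t)"
  using assms by (auto simp: less_4_cases R_mat_def mat_of_rows_list_index)

lemma g_hat_gauge:
  assumes "l \<noteq> 0" "i < 2" "k < 2"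
  shows "g_hat a b c d \<theta> l $$ (i, k) = (l ^ i * inverse (l ^ k)) *\<^sub>C g_mat a b c d \<theta> l $$ (1 - i, k)"
  using assms
  by (auto simp: less_2_cases_iff g_hat_def g_mat_def mat_of_rows_list_index
      scaleC_scaleC scaleC_one)

text \<open>Conjugation by the gauge cancels at the summation index and leaves only its values at the outer
  indices \<open>r\<close> and \<open>s\<close>. The matrix exchanging the basis vectors multiplies \<open>g\<close> from the left only;
  on the side where \<open>R\<close> stands in front, it is moved past \<open>R\<close> by reversing the order of
  summation, so on both sides it ends up reversing the row.\<close>

lemma hat_exchange_defect:
  fixes a b c d \<theta> :: "'a::complex_algebra_1"
  assumes nz: "l \<noteq> 0" "m \<noteq> 0" and rs: "r < 4" "s < 4"
  shows "exchange_defect (R_hat q l) (g_hat a b c d \<theta> (l * m)) (g_hat a b c d \<theta> m) r s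
       = (gauge l m r * inverse (gauge l m s)) *\<^sub>C
         exchange_defect (R_mat q l) (g_mat a b c d \<theta> (l * m)) (g_mat a b c d \<theta> m) (3 - r) s"
proof -
  let ?\<rho> = "gauge l m"
  let ?G = "g_mat a b c d \<theta> (l * m)" and ?H = "g_mat a b c d \<theta> m"
  let ?G' = "g_hat a b c d \<theta> (l * m)" and ?H' = "g_hat a b c d \<theta> m"
  have flip: "(3 - t) div 2 = 1 - t div 2" "(3 - t) mod 2 = 1 - t mod 2" "t div 2 < 2" "t mod 2 < 2"
    if "t < 4" for t :: nat
    using that by (auto simp: less_4_cases)
  have bij: "bij_betw (\<lambda>t. 3 - t) {..<4} {..<4::nat}"
    by (rule bij_betw_byWitness[where f' = "\<lambda>t. 3 - t"]) auto
  have gauge_cancel: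
    "x * inverse y * z * (y * w) = x * w * z"
    "y * inverse w * z * (x * inverse y) = x * inverse w * z"
    if "y \<noteq> 0" for x y z w :: complex
    using that by simp_all
  have GH: "?G' $$ (t div 2, s div 2) * ?H' $$ (t mod 2, s mod 2)
      = (?\<rho> t * inverse (?\<rho> s)) *\<^sub>C
        (?G $$ ((3 - t) div 2, s div 2) * ?H $$ ((3 - t) mod 2, s mod 2))"
    if "t < 4" for t
    using that nz rs
    by (simp add: g_hat_gauge flip mult_scaleC_left mult_scaleC_right scaleC_scaleC gauge_def mult_ac)
  have HG: "?H' $$ (r mod 2, t mod 2) * ?G' $$ (r div 2, t div 2)
      = (?\<rho> r * inverse (?\<rho> t)) *\<^sub>C
        (?H $$ ((3 - r) mod 2, t mod 2) * ?G $$ ((3 - r) div 2, t div 2))"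
    if "t < 4" for t
    using that nz rs
    by (simp add: g_hat_gauge flip mult_scaleC_left mult_scaleC_right scaleC_scaleC gauge_def mult_ac)
  have "(\<Sum>t<4. R_hat q l $$ (r, t) *\<^sub>C (?G' $$ (t div 2, s div 2) * ?H' $$ (t mod 2, s mod 2)))
      = (\<Sum>t<4. (?\<rho> r * inverse (?\<rho> s)) *\<^sub>C (R_mat q l $$ (3 - r, 3 - t) *\<^sub>C
          (?G $$ ((3 - t) div 2, s div 2) * ?H $$ ((3 - t) mod 2, s mod 2))))"
    using nz rs
    by (intro sum.cong)
      (simp_all add: R_hat_gauge[of l m] R_mat_flip GH scaleC_scaleC gauge_cancel gauge_nonzero)
  also have "\<dots> = (?\<rho> r * inverse (?\<rho> s)) *\<^sub>C (\<Sum>t<4. R_mat q l $$ (3 - r, t) *\<^sub>C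
          (?G $$ (t div 2, s div 2) * ?H $$ (t mod 2, s mod 2)))"
    unfolding scaleC_sum_right by (rule sum.reindex_bij_betw[OF bij])
  finally have lhs: "(\<Sum>t<4. R_hat q l $$ (r, t) *\<^sub>C
        (?G' $$ (t div 2, s div 2) * ?H' $$ (t mod 2, s mod 2))) = \<dots>" .
  have rhs: "(\<Sum>t<4. R_hat q l $$ (t, s) *\<^sub>C (?H' $$ (r mod 2, t mod 2) * ?G' $$ (r div 2, t div 2)))
      = (?\<rho> r * inverse (?\<rho> s)) *\<^sub>C (\<Sum>t<4. R_mat q l $$ (t, s) *\<^sub>C
          (?H $$ ((3 - r) mod 2, t mod 2) * ?G $$ ((3 - r) div 2, t div 2)))"
    unfolding scaleC_sum_right using nz rs
    by (intro sum.cong)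
      (simp_all add: R_hat_gauge[of l m] HG scaleC_scaleC gauge_cancel gauge_nonzero)
  show ?thesis
    unfolding exchange_defect_def lhs rhs scaleC_diff_right ..
qed

lemma hat_exchange_iff_exchange:
  assumes "l \<noteq> 0" "m \<noteq> 0"
  shows "(\<forall>r<4. \<forall>s<4.
            exchange_defect (R_hat q l) (g_hat a b c d \<theta> (l * m)) (g_hat a b c d \<theta> m) r s = 0)
     \<longleftrightarrow> (\<forall>r<4. \<forall>s<4.
            exchange_defect (R_mat q l) (g_mat a b c d \<theta> (l * m)) (g_mat a b c d \<theta> m) r s = 0)"
    (is "(\<forall>r<4. \<forall>s<4. ?hat r s = 0) \<longleftrightarrow> (\<forall>r<4. \<forall>s<4. ?plain r s = 0)")
proof -
  have "?hat r s = 0 \<longleftrightarrow> ?plain (3 - r) s = 0" if "r < 4" "s < 4" for r s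
    using assms that by (simp add: hat_exchange_defect scaleC_eq_0_iff gauge_nonzero)
  then have "(\<forall>r<4. \<forall>s<4. ?hat r s = 0) \<longleftrightarrow> (\<forall>r<4. \<forall>s<4. ?plain (3 - r) s = 0)"
    by blast
  also have "\<dots> \<longleftrightarrow> (\<forall>r<4. \<forall>s<4. ?plain r s = 0)"
  proof -
    have "(\<forall>r<4. P (3 - r)) \<longleftrightarrow> (\<forall>r<4. P r)" for P :: "nat \<Rightarrow> bool"
      unfolding less_4_cases by (auto simp: numeral_eq_Suc)
    from this[of "\<lambda>r. \<forall>s<4. ?plain r s = 0"] show ?thesis .
  qed
  finally show ?thesis .
qed

theorem proposition2:
  fixes \<gamma> :: real and q :: complex
    and a b c d \<theta> :: "'a::complex_algebra_1"
  assumes "0 < \<gamma>" and "\<gamma> < pi" and "q = exp (\<i> * complex_of_real \<gamma>)"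
  shows "((\<forall>l m. l \<noteq> 0 \<longrightarrow> m \<noteq> 0 \<longrightarrow>
             leg12 (R_mat q l) * leg13 (g_mat a b c d \<theta> (l * m)) * leg23 (g_mat a b c d \<theta> m)
           = leg23 (g_mat a b c d \<theta> m) * leg13 (g_mat a b c d \<theta> (l * m)) * leg12 (R_mat q l))
          \<longleftrightarrow> GLq2_tilde_relations q a b c d \<theta>)
       \<and> ((\<forall>l m. l \<noteq> 0 \<longrightarrow> m \<noteq> 0 \<longrightarrow>
             leg12 (R_hat q l) * leg13 (g_hat a b c d \<theta> (l * m)) * leg23 (g_hat a b c d \<theta> m)
           = leg23 (g_hat a b c d \<theta> m) * leg13 (g_hat a b c d \<theta> (l * m)) * leg12 (R_hat q l))
          \<longleftrightarrow> GLq2_tilde_relations q a b c d \<theta>)"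
proof -
  have "q \<noteq> 0"
    using assms(3) by simp
  note iff = g_exchange_iff_relations[OF this, of a b c d \<theta>]
  have hat: "(\<forall>l m. l \<noteq> 0 \<longrightarrow> m \<noteq> 0 \<longrightarrow> (\<forall>r<4. \<forall>s<4.
        exchange_defect (R_hat q l) (g_hat a b c d \<theta> (l * m)) (g_hat a b c d \<theta> m) r s = 0))
      \<longleftrightarrow> (\<forall>l m. l \<noteq> 0 \<longrightarrow> m \<noteq> 0 \<longrightarrow> (\<forall>r<4. \<forall>s<4.
        exchange_defect (R_mat q l) (g_mat a b c d \<theta> (l * m)) (g_mat a b c d \<theta> m) r s = 0))"
    by (intro all_cong1 imp_cong refl hat_exchange_iff_exchange)
  show ?thesis
    unfolding exchange_relation_iff[OF R_carrier(1)] exchange_relation_iff[OF R_carrier(2)]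
    by (intro conjI iff hat[THEN trans])
qed

end
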